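(* Let $U$ and $U'$ be nonempty sets and let each of $U$, $U'$, $U\times U'$ carry a binary relation, all three denoted $\prec$, and a domain of nonempty subsets, as described in the context. For $X$ in the relevant domain let $\mu(X)$ be the set of $\prec$-minimal elements of $X$, so that for all $\sigma,\tau$ in the same set, $\sigma\prec\tau \Leftrightarrow \tau\notin\mu(\{\sigma,\tau\})$. Assume that all three relations are smooth. Then $\mu$ satisfies $(\mu*1)$: $\mu(\Sigma\times\Sigma')=\mu(\Sigma)\times\mu(\Sigma')$ for all $\Sigma\in\mathcal{Y}$ and $\Sigma'\in\mathcal{Y}'$ (or, equivalently, the condition $(s*s)$: for all $\Sigma\in\mathcal{Y}$, $\Sigma'\in\mathcal{Y}'$, $\Gamma\subseteq\Sigma$, $\Gamma'\subseteq\Sigma'$, the set $\Gamma\times\Gamma'$ is small in $\Sigma\times\Sigma'$ if and only if $\Gamma$ is small in $\Sigma$ or $\Gamma'$ is small in $\Sigma'$) if and only if $\prec$ is a GH relation.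
   Context: Domains: $\mathcal{Y}$, $\mathcal{Y}'$, $\mathcal{Y}''$ are families of nonempty subsets of $U$, $U'$, $U\times U'$ respectively, each containing all nonempty subsets with at most two elements, and such that $\Sigma\times\Sigma'\in\mathcal{Y}''$ whenever $\Sigma\in\mathcal{Y}$ and $\Sigma'\in\mathcal{Y}'$. Elements of $U\times U'$ are written as concatenations $\sigma\sigma'$ with $\sigma\in U$, $\sigma'\in U'$. Minimal elements: $\mu(X)=\{x\in X : \text{there is no } y\in X \text{ with } y\prec x\}$. Smoothness: $\prec$ is smooth if for every $X$ in the corresponding domain and every $x\in X$, either $x\in\mu(X)$ or there is $y\in\mu(X)$ with $y\prec x$. Size: for $X$ in a domain, $A\subseteq X$ is big in $X$ iff $\mu(X)\subseteq A$, and $A\subseteq X$ is small in $X$ iff $X\setminus A$ is big in $X$ (that is, iff $A\cap\mu(X)=\emptyset$). GH (general Hamming) relation: write $\sigma\preceq\tau$ for "$\sigma\prec\tau$ or $\sigma=\tau$". The relation $\prec$ (on $U$, $U'$ and $U\times U'$) is a GH relation iff for all $\sigma,\tau\in U$ and $\sigma',\tau'\in U'$: (GH1) if $\sigma\preceq\tau$, $\sigma'\preceq\tau'$ and ($\sigma\prec\tau$ or $\sigma'\prec\tau'$), then $\sigma\sigma'\prec\tau\tau'$; (GH2) if $\sigma\sigma'\prec\tau\tau'$, then $\sigma\prec\tau$ or $\sigma'\prec\tau'$. *)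

theory Defs
  imports Main
begin

text \<open>
  \<open>U\<close>, \<open>U'\<close> are carrier sets inside types and an element \<open>\<sigma>\<sigma>'\<close> of \<open>U \<times> U'\<close> is the pair
  \<open>(\<sigma>, \<sigma>')\<close>. The three relations written \<open>\<prec>\<close> are separate predicates; only their
  restrictions to the carriers matter in the definitions below.
\<close>

definition dom_family :: "'a set \<Rightarrow> 'a set set \<Rightarrow> bool" where
  "dom_family U Y \<longleftrightarrow>
     (\<forall>X\<in>Y. X \<subseteq> U \<and> X \<noteq> {}) \<and>
     (\<forall>X. X \<subseteq> U \<and> X \<noteq> {} \<and> finite X \<and> card X \<le> 2 \<longrightarrow> X \<in> Y)"

definition mu :: "('a \<Rightarrow> 'a \<Rightarrow> bool) \<Rightarrow> 'a set \<Rightarrow> 'a set" where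
  "mu r X = {x \<in> X. \<not> (\<exists>y\<in>X. r y x)}"

definition smooth_on :: "'a set set \<Rightarrow> ('a \<Rightarrow> 'a \<Rightarrow> bool) \<Rightarrow> bool" where
  "smooth_on Y r \<longleftrightarrow> (\<forall>X\<in>Y. \<forall>x\<in>X. x \<in> mu r X \<or> (\<exists>y\<in>mu r X. r y x))"

definition big_in :: "('a \<Rightarrow> 'a \<Rightarrow> bool) \<Rightarrow> 'a set \<Rightarrow> 'a set \<Rightarrow> bool" where
  "big_in r X A \<longleftrightarrow> A \<subseteq> X \<and> mu r X \<subseteq> A"

definition small_in :: "('a \<Rightarrow> 'a \<Rightarrow> bool) \<Rightarrow> 'a set \<Rightarrow> 'a set \<Rightarrow> bool" where
  "small_in r X A \<longleftrightarrow> A \<subseteq> X \<and> big_in r X (X - A)"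

definition GH1 ::
  "'a set \<Rightarrow> 'b set \<Rightarrow> ('a \<Rightarrow> 'a \<Rightarrow> bool) \<Rightarrow> ('b \<Rightarrow> 'b \<Rightarrow> bool) \<Rightarrow>
   ('a \<times> 'b \<Rightarrow> 'a \<times> 'b \<Rightarrow> bool) \<Rightarrow> bool" where
  "GH1 U U' r r' r'' \<longleftrightarrow>
     (\<forall>\<sigma>\<in>U. \<forall>\<tau>\<in>U. \<forall>\<sigma>'\<in>U'. \<forall>\<tau>'\<in>U'.
        (r \<sigma> \<tau> \<or> \<sigma> = \<tau>) \<and> (r' \<sigma>' \<tau>' \<or> \<sigma>' = \<tau>') \<and> (r \<sigma> \<tau> \<or> r' \<sigma>' \<tau>') \<longrightarrow>
        r'' (\<sigma>, \<sigma>') (\<tau>, \<tau>'))"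

definition GH2 ::
  "'a set \<Rightarrow> 'b set \<Rightarrow> ('a \<Rightarrow> 'a \<Rightarrow> bool) \<Rightarrow> ('b \<Rightarrow> 'b \<Rightarrow> bool) \<Rightarrow>
   ('a \<times> 'b \<Rightarrow> 'a \<times> 'b \<Rightarrow> bool) \<Rightarrow> bool" where
  "GH2 U U' r r' r'' \<longleftrightarrow>
     (\<forall>\<sigma>\<in>U. \<forall>\<tau>\<in>U. \<forall>\<sigma>'\<in>U'. \<forall>\<tau>'\<in>U'.
        r'' (\<sigma>, \<sigma>') (\<tau>, \<tau>') \<longrightarrow> r \<sigma> \<tau> \<or> r' \<sigma>' \<tau>')"

definition GH_relation ::
  "'a set \<Rightarrow> 'b set \<Rightarrow> ('a \<Rightarrow> 'a \<Rightarrow> bool) \<Rightarrow> ('b \<Rightarrow> 'b \<Rightarrow> bool) \<Rightarrow>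
   ('a \<times> 'b \<Rightarrow> 'a \<times> 'b \<Rightarrow> bool) \<Rightarrow> bool" where
  "GH_relation U U' r r' r'' \<longleftrightarrow> GH1 U U' r r' r'' \<and> GH2 U U' r r' r''"

text \<open>
  Smoothness on singletons makes the relation irreflexive on the carrier, so \<open>\<prec>\<close> can be recovered from the minimal elements of two-element sets.
\<close>

lemma rel_iff_notin_mu_pair:
  assumes "dom_family U Y" "smooth_on Y r" "\<sigma> \<in> U" "\<tau> \<in> U"
  shows "r \<sigma> \<tau> \<longleftrightarrow> \<tau> \<notin> mu r {\<sigma>, \<tau>}"
proof -
  have "{\<tau>} \<in> Y"
    using assms unfolding dom_family_def by simp
  then have "\<not> r \<tau> \<tau>"
    using assms(2) unfolding smooth_on_def mu_def by auto
  then show ?thesis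
    unfolding mu_def by auto
qed

end

theory Submission
  imports Defs
begin

text \<open>
  Smallness in \<open>X\<close> means disjointness from \<open>mu r X\<close>, so the condition on small products is
  the product formula for \<open>mu\<close> read pointwise: a product of two sets misses a product of two
  sets iff one of the factors does, and singletons \<open>\<Gamma>\<close>, \<open>\<Gamma>'\<close> recover the formula
  (\<open>mu_Times_iff_small_Times\<close>).

  From a GH relation the product formula follows directly: by GH1, a non-minimal coordinate makes
  the pair non-minimal (keep the other coordinate fixed), and by GH2 anything below a pair is below
  it in some coordinate. Conversely, the product formula is applied to two-element sets
  \<open>{\<sigma>, \<tau>}\<close> and \<open>{\<sigma>', \<tau>'}\<close>. For GH2 it says that a pair of minimal elements is
  minimal. For GH1 smoothness is essential: if \<open>\<sigma>\<close> lies below or equals \<open>\<tau>\<close>, then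
  \<open>\<sigma>\<close> is the only minimal element of \<open>{\<sigma>, \<tau>}\<close>, and likewise for the primed elements,
  so \<open>(\<sigma>, \<sigma>')\<close> is the only minimal element of the product; smoothness puts it below every
  other element, in particular below \<open>(\<tau>, \<tau>')\<close>.
\<close>

lemma small_in_iff: "small_in r X A \<longleftrightarrow> A \<subseteq> X \<and> A \<inter> mu r X = {}"
  unfolding small_in_def big_in_def mu_def by blast

lemma mu_Times_iff_small_Times:
  "mu r'' (\<Sigma> \<times> \<Sigma>') = mu r \<Sigma> \<times> mu r' \<Sigma>' \<longleftrightarrow>
   (\<forall>\<Gamma> \<Gamma>'. \<Gamma> \<subseteq> \<Sigma> \<and> \<Gamma>' \<subseteq> \<Sigma>' \<longrightarrow>
      (small_in r'' (\<Sigma> \<times> \<Sigma>') (\<Gamma> \<times> \<Gamma>') \<longleftrightarrow> small_in r \<Sigma> \<Gamma> \<or> small_in r' \<Sigma>' \<Gamma>'))"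
  (is "?prod \<longleftrightarrow> ?small")
proof
  assume ?prod
  then show ?small
    by (auto simp: small_in_iff)
next
  assume small: ?small
  have "(x, x') \<in> mu r'' (\<Sigma> \<times> \<Sigma>') \<longleftrightarrow> x \<in> mu r \<Sigma> \<and> x' \<in> mu r' \<Sigma>'"
    if "x \<in> \<Sigma>" "x' \<in> \<Sigma>'" for x x'
    using small[rule_format, of "{x}" "{x'}"] that by (auto simp: small_in_iff)
  then show ?prod
    unfolding mu_def by blast
qed

lemma pair_mem_dom_family:
  assumes "dom_family U Y" "x \<in> U" "y \<in> U"
  shows "{x, y} \<in> Y"
proof -
  have "card {x, y} \<le> 2"
    by (simp add: card_insert_if)
  then show ?thesis
    using assms unfolding dom_family_def by simp
qed

lemma mu_pair_eq_singleton:
  assumes "dom_family U Y" "smooth_on Y r" "x \<in> U" "y \<in> U" "r x y \<or> x = y"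
  shows "mu r {x, y} = {x}"
proof -
  have "{x, y} \<in> Y"
    by (rule pair_mem_dom_family[OF assms(1,3,4)])
  then have smooth: "z \<in> mu r {x, y} \<or> (\<exists>w\<in>mu r {x, y}. r w z)" if "z \<in> {x, y}" for z
    using assms(2) that unfolding smooth_on_def by blast
  have "mu r {x, y} \<subseteq> {x}"
    using assms(5) unfolding mu_def by auto
  moreover have "mu r {x, y} \<noteq> {}"
    using smooth[of x] by blast
  ultimately show ?thesis
    by blast
qed

lemma mu_Times_of_GH_relation:
  assumes "GH_relation U U' r r' r''" "\<Sigma> \<subseteq> U" "\<Sigma>' \<subseteq> U'"
  shows "mu r'' (\<Sigma> \<times> \<Sigma>') = mu r \<Sigma> \<times> mu r' \<Sigma>'"
proof -
  have GH1: "r'' (\<sigma>, \<sigma>') (\<tau>, \<tau>')"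
    if "\<sigma> \<in> \<Sigma>" "\<tau> \<in> \<Sigma>" "\<sigma>' \<in> \<Sigma>'" "\<tau>' \<in> \<Sigma>'"
      "r \<sigma> \<tau> \<or> \<sigma> = \<tau>" "r' \<sigma>' \<tau>' \<or> \<sigma>' = \<tau>'" "r \<sigma> \<tau> \<or> r' \<sigma>' \<tau>'"
    for \<sigma> \<tau> \<sigma>' \<tau>'
    using that assms unfolding GH_relation_def GH1_def by blast
  have GH2: "r \<sigma> \<tau> \<or> r' \<sigma>' \<tau>'"
    if "\<sigma> \<in> \<Sigma>" "\<tau> \<in> \<Sigma>" "\<sigma>' \<in> \<Sigma>'" "\<tau>' \<in> \<Sigma>'" "r'' (\<sigma>, \<sigma>') (\<tau>, \<tau>')"
    for \<sigma> \<tau> \<sigma>' \<tau>'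
    using that assms unfolding GH_relation_def GH2_def by blast
  show ?thesis
  proof (intro equalityI subrelI)
    fix x x' assume min: "(x, x') \<in> mu r'' (\<Sigma> \<times> \<Sigma>')"
    then have "x \<in> \<Sigma>" "x' \<in> \<Sigma>'"
      unfolding mu_def by auto
    moreover have "\<not> r y x" if "y \<in> \<Sigma>" for y
      using GH1[of y x x' x'] min that calculation unfolding mu_def by blast
    moreover have "\<not> r' y' x'" if "y' \<in> \<Sigma>'" for y'
      using GH1[of x x y' x'] min that calculation(1,2) unfolding mu_def by blast
    ultimately show "(x, x') \<in> mu r \<Sigma> \<times> mu r' \<Sigma>'"
      unfolding mu_def by blast
  next
    fix x x' assume "(x, x') \<in> mu r \<Sigma> \<times> mu r' \<Sigma>'"
    then show "(x, x') \<in> mu r'' (\<Sigma> \<times> \<Sigma>')"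
      using GH2 unfolding mu_def by blast
  qed
qed

lemma GH_relation_of_mu_Times:
  assumes dom: "dom_family U Y" "dom_family U' Y'"
    and Times: "\<forall>\<Sigma>\<in>Y. \<forall>\<Sigma>'\<in>Y'. \<Sigma> \<times> \<Sigma>' \<in> Y''"
    and smooth: "smooth_on Y r" "smooth_on Y' r'" "smooth_on Y'' r''"
    and mu_Times: "\<forall>\<Sigma>\<in>Y. \<forall>\<Sigma>'\<in>Y'. mu r'' (\<Sigma> \<times> \<Sigma>') = mu r \<Sigma> \<times> mu r' \<Sigma>'"
  shows "GH_relation U U' r r' r''"
proof -
  have mu_pairs: "mu r'' ({\<sigma>, \<tau>} \<times> {\<sigma>', \<tau>'}) = mu r {\<sigma>, \<tau>} \<times> mu r' {\<sigma>', \<tau>'}"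
    and pairs: "{\<sigma>, \<tau>} \<times> {\<sigma>', \<tau>'} \<in> Y''"
    if "\<sigma> \<in> U" "\<tau> \<in> U" "\<sigma>' \<in> U'" "\<tau>' \<in> U'" for \<sigma> \<tau> \<sigma>' \<tau>'
    using mu_Times Times that pair_mem_dom_family[OF dom(1)] pair_mem_dom_family[OF dom(2)]
    by blast+
  have "r'' (\<sigma>, \<sigma>') (\<tau>, \<tau>')"
    if carrier: "\<sigma> \<in> U" "\<tau> \<in> U" "\<sigma>' \<in> U'" "\<tau>' \<in> U'"
      and le: "r \<sigma> \<tau> \<or> \<sigma> = \<tau>" "r' \<sigma>' \<tau>' \<or> \<sigma>' = \<tau>'"
      and less: "r \<sigma> \<tau> \<or> r' \<sigma>' \<tau>'"
    for \<sigma> \<tau> \<sigma>' \<tau>'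
  proof -
    have "mu r {\<sigma>, \<tau>} = {\<sigma>}" "mu r' {\<sigma>', \<tau>'} = {\<sigma>'}"
      using mu_pair_eq_singleton[OF dom(1) smooth(1) carrier(1,2) le(1)]
        mu_pair_eq_singleton[OF dom(2) smooth(2) carrier(3,4) le(2)] by simp_all
    then have mu: "mu r'' ({\<sigma>, \<tau>} \<times> {\<sigma>', \<tau>'}) = {(\<sigma>, \<sigma>')}"
      using mu_pairs[OF carrier] by simp
    have "\<tau> \<notin> mu r {\<sigma>, \<tau>} \<or> \<tau>' \<notin> mu r' {\<sigma>', \<tau>'}"
      using less unfolding mu_def by blast
    then have "(\<tau>, \<tau>') \<notin> mu r'' ({\<sigma>, \<tau>} \<times> {\<sigma>', \<tau>'})"
      using mu_pairs[OF carrier] by blast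
    then have "\<exists>y\<in>mu r'' ({\<sigma>, \<tau>} \<times> {\<sigma>', \<tau>'}). r'' y (\<tau>, \<tau>')"
      using smooth(3) pairs[OF carrier] unfolding smooth_on_def by blast
    then show ?thesis
      using mu by simp
  qed
  moreover have "r \<sigma> \<tau> \<or> r' \<sigma>' \<tau>'"
    if carrier: "\<sigma> \<in> U" "\<tau> \<in> U" "\<sigma>' \<in> U'" "\<tau>' \<in> U'"
      and less: "r'' (\<sigma>, \<sigma>') (\<tau>, \<tau>')"
    for \<sigma> \<tau> \<sigma>' \<tau>'
  proof -
    have "(\<tau>, \<tau>') \<notin> mu r'' ({\<sigma>, \<tau>} \<times> {\<sigma>', \<tau>'})"
      using less unfolding mu_def by blast
    then have "\<tau> \<notin> mu r {\<sigma>, \<tau>} \<or> \<tau>' \<notin> mu r' {\<sigma>', \<tau>'}"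
      using mu_pairs[OF carrier] by blast
    then show ?thesis
      using rel_iff_notin_mu_pair[OF dom(1) smooth(1) carrier(1,2)]
        rel_iff_notin_mu_pair[OF dom(2) smooth(2) carrier(3,4)] by simp
  qed
  ultimately show ?thesis
    unfolding GH_relation_def GH1_def GH2_def by blast
qed

theorem proposition4p2:
  fixes U :: "'a set" and U' :: "'b set"
    and Y :: "'a set set" and Y' :: "'b set set" and Y'' :: "('a \<times> 'b) set set"
    and r :: "'a \<Rightarrow> 'a \<Rightarrow> bool" and r' :: "'b \<Rightarrow> 'b \<Rightarrow> bool"
    and r'' :: "'a \<times> 'b \<Rightarrow> 'a \<times> 'b \<Rightarrow> bool"
  assumes "U \<noteq> {}" and "U' \<noteq> {}"
    and "dom_family U Y" and "dom_family U' Y'" and "dom_family (U \<times> U') Y''"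
    and "\<forall>\<Sigma>\<in>Y. \<forall>\<Sigma>'\<in>Y'. \<Sigma> \<times> \<Sigma>' \<in> Y''"
    and "smooth_on Y r" and "smooth_on Y' r'" and "smooth_on Y'' r''"
  shows "((\<forall>\<Sigma>\<in>Y. \<forall>\<Sigma>'\<in>Y'. mu r'' (\<Sigma> \<times> \<Sigma>') = mu r \<Sigma> \<times> mu r' \<Sigma>') \<longleftrightarrow>
          GH_relation U U' r r' r'') \<and>
         ((\<forall>\<Sigma>\<in>Y. \<forall>\<Sigma>'\<in>Y'. mu r'' (\<Sigma> \<times> \<Sigma>') = mu r \<Sigma> \<times> mu r' \<Sigma>') \<longleftrightarrow>
          (\<forall>\<Sigma>\<in>Y. \<forall>\<Sigma>'\<in>Y'. \<forall>\<Gamma> \<Gamma>'. \<Gamma> \<subseteq> \<Sigma> \<and> \<Gamma>' \<subseteq> \<Sigma>' \<longrightarrow>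
             (small_in r'' (\<Sigma> \<times> \<Sigma>') (\<Gamma> \<times> \<Gamma>') \<longleftrightarrow> small_in r \<Sigma> \<Gamma> \<or> small_in r' \<Sigma>' \<Gamma>')))"
  (is "(?prod \<longleftrightarrow> ?GH) \<and> (?prod \<longleftrightarrow> ?small)")
proof
  show "?prod \<longleftrightarrow> ?GH"
  proof
    assume ?prod
    then show ?GH
      by (rule GH_relation_of_mu_Times[OF assms(3,4,6-9)])
  next
    assume GH: ?GH
    show ?prod
    proof (intro ballI)
      fix \<Sigma> \<Sigma>' assume "\<Sigma> \<in> Y" "\<Sigma>' \<in> Y'"
      then have "\<Sigma> \<subseteq> U" "\<Sigma>' \<subseteq> U'"
        using assms(3,4) unfolding dom_family_def by blast+
      with GH show "mu r'' (\<Sigma> \<times> \<Sigma>') = mu r \<Sigma> \<times> mu r' \<Sigma>'"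
        by (rule mu_Times_of_GH_relation)
    qed
  qed
  show "?prod \<longleftrightarrow> ?small"
    by (simp only: mu_Times_iff_small_Times)
qed

end
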